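(* For every integer $m$, the $3$-strand braid $\sigma_1\sigma_2^{2m+1}\in B_3$ is not order-preserving.
   Context: $F_n=\langle x_1,\dots,x_n\rangle$ is the free group of rank $n$, and $B_n$ is the $n$-strand braid group with Artin generators $\sigma_1,\dots,\sigma_{n-1}$. $B_n$ acts on $F_n$ on the left by automorphisms (braid words are read from right to left, so a product of braids acts as the composition of the corresponding automorphisms, rightmost first), where $\sigma_i$ acts by $x_i\mapsto x_{i+1}$, $x_{i+1}\mapsto x_{i+1}^{-1}x_ix_{i+1}$, and $x_j\mapsto x_j$ for $j\neq i,i+1$. We write $\beta(\cdot)$ for the action of $\beta$ on elements and subsets of $F_n$. A subset $P\subset F_n$ is a (conjugation-invariant) positive cone if (1) $P\cdot P\subset P$; (2) $F_n=P\sqcup P^{-1}\sqcup\{1\}$ (disjoint union); (3) $gPg^{-1}=P$ for all $g\in F_n$. A braid $\beta\in B_n$ is order-preserving if there is a positive cone $P$ of $F_n$ with $\beta(P)=P$. *)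

theory Defs
  imports "HOL-Algebra.Coset" "HOL-Algebra.Bij"
begin

section \<open>Free groups\<close>

text \<open>A letter is a pair (s, b), standing for the generator s if b is true and for its inverse
  otherwise. The free group on S consists of the freely reduced words in these letters.\<close>

type_synonym 'a letter = "'a \<times> bool"

definition inv_letter :: "'a letter \<Rightarrow> 'a letter" where
  "inv_letter x = (fst x, \<not> snd x)"

definition reduced :: "'a letter list \<Rightarrow> bool" where
  "reduced w \<longleftrightarrow> successively (\<lambda>x y. y \<noteq> inv_letter x) w"

fun push_letter :: "'a letter \<Rightarrow> 'a letter list \<Rightarrow> 'a letter list" where
  "push_letter x [] = [x]"
| "push_letter x (y # w) = (if y = inv_letter x then w else x # y # w)"

definition reduce :: "'a letter list \<Rightarrow> 'a letter list" where
  "reduce w = foldr push_letter w []"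

definition free_group :: "'a set \<Rightarrow> 'a letter list monoid" where
  "free_group S = \<lparr>carrier = {w. fst ` set w \<subseteq> S \<and> reduced w},
                   mult = (\<lambda>u v. reduce (u @ v)),
                   one = []\<rparr>"

definition gen :: "'a \<Rightarrow> 'a letter list" where
  "gen s = [(s, True)]"

text \<open>The homomorphism from a free group to H that extends a map f of the generators.\<close>

definition free_lift :: "('b, 'c) monoid_scheme \<Rightarrow> ('a \<Rightarrow> 'b) \<Rightarrow> 'a letter list \<Rightarrow> 'b" where
  "free_lift H f w =
     foldr (\<lambda>(s, b) y. (if b then f s else inv\<^bsub>H\<^esub> (f s)) \<otimes>\<^bsub>H\<^esub> y) w \<one>\<^bsub>H\<^esub>"

lemma inv_letter_inv_letter [simp]: "inv_letter (inv_letter x) = x"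
  by (simp add: inv_letter_def)

lemma inv_letter_neq [simp]: "inv_letter x \<noteq> x" "x \<noteq> inv_letter x"
  by (auto simp: inv_letter_def prod_eq_iff)

lemma fst_inv_letter [simp]: "fst (inv_letter x) = fst x"
  by (simp add: inv_letter_def)

lemma reduced_Nil [simp]: "reduced []"
  by (simp add: reduced_def)

lemma reduced_single [simp]: "reduced [x]"
  by (simp add: reduced_def)

lemma reduced_Cons_Cons [simp]:
  "reduced (x # y # w) \<longleftrightarrow> y \<noteq> inv_letter x \<and> reduced (y # w)"
  by (simp add: reduced_def)

lemma reduced_ConsD: "reduced (x # w) \<Longrightarrow> reduced w"
  by (cases w) auto

lemma reduced_push: "reduced w \<Longrightarrow> reduced (push_letter x w)"
  by (cases w) (auto dest: reduced_ConsD)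

lemma set_push: "set (push_letter x w) \<subseteq> insert x (set w)"
  by (cases w) auto

lemma push_inv_push: "reduced w \<Longrightarrow> push_letter (inv_letter x) (push_letter x w) = w"
  by (cases w; cases "tl w") auto

lemma push_push_inv: "reduced w \<Longrightarrow> push_letter x (push_letter (inv_letter x) w) = w"
  using push_inv_push[of w "inv_letter x"] by simp

lemma reduced_foldr: "reduced v \<Longrightarrow> reduced (foldr push_letter u v)"
  by (induction u) (auto intro: reduced_push)

lemma reduced_reduce: "reduced (reduce w)"
  by (simp add: reduce_def reduced_foldr)

lemma reduce_reduced: "reduced w \<Longrightarrow> reduce w = w"
proof (induction w)
  case (Cons x w)
  then have "reduce w = w" by (auto dest: reduced_ConsD)
  with Cons.prems show ?case by (cases w) (auto simp: reduce_def)
qed (simp add: reduce_def)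

lemma set_reduce: "set (reduce w) \<subseteq> set w"
  unfolding reduce_def using set_push by (induction w) fastforce+

lemma reduce_append: "reduce (u @ v) = foldr push_letter u (reduce v)"
  by (simp add: reduce_def)

lemma foldr_push_letter:
  "reduced w \<Longrightarrow> foldr push_letter (push_letter x v) w = push_letter x (foldr push_letter v w)"
  by (cases v) (auto simp: push_push_inv reduced_foldr)

lemma foldr_reduce: "reduced w \<Longrightarrow> foldr push_letter (reduce u) w = foldr push_letter u w"
  unfolding reduce_def by (induction u) (auto simp: foldr_push_letter)

lemma free_group_simps:
  "\<one>\<^bsub>free_group S\<^esub> = []"
  "u \<otimes>\<^bsub>free_group S\<^esub> v = reduce (u @ v)"
  by (simp_all add: free_group_def)

lemma carrier_free_group:
  "w \<in> carrier (free_group S) \<longleftrightarrow> fst ` set w \<subseteq> S \<and> reduced w"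
  by (simp add: free_group_def)

lemma foldr_push_inverse:
  "reduced v \<Longrightarrow> foldr push_letter (rev (map inv_letter w)) (foldr push_letter w v) = v"
  by (induction w) (auto simp: push_inv_push reduced_foldr)

lemma group_free_group: "group (free_group S)"
proof (rule groupI)
  fix u v assume "u \<in> carrier (free_group S)" "v \<in> carrier (free_group S)"
  then show "u \<otimes>\<^bsub>free_group S\<^esub> v \<in> carrier (free_group S)"
    using set_reduce[of "u @ v"] by (fastforce simp: free_group_simps carrier_free_group reduced_reduce)
next
  fix u v w assume "w \<in> carrier (free_group S)"
  then show "u \<otimes>\<^bsub>free_group S\<^esub> v \<otimes>\<^bsub>free_group S\<^esub> w
      = u \<otimes>\<^bsub>free_group S\<^esub> (v \<otimes>\<^bsub>free_group S\<^esub> w)"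
    using foldr_reduce[of w "u @ v"]
    by (simp add: free_group_simps carrier_free_group reduce_append[of "reduce _" w]
        reduce_append[of u "reduce _"] reduce_reduced reduced_reduce)
       (simp add: reduce_append reduce_reduced)
next
  fix w assume w: "w \<in> carrier (free_group S)"
  define w' where "w' = reduce (rev (map inv_letter w))"
  have "w' \<in> carrier (free_group S)"
    using w set_reduce[of "rev (map inv_letter w)"]
    by (fastforce simp: carrier_free_group w'_def reduced_reduce)
  moreover have "w' \<otimes>\<^bsub>free_group S\<^esub> w = \<one>\<^bsub>free_group S\<^esub>"
    using w foldr_push_inverse[of "[]" w]
    by (simp add: free_group_simps w'_def carrier_free_group reduce_append foldr_reduce reduced_reduce)
       (simp add: reduce_def)
  ultimately show "\<exists>y\<in>carrier (free_group S). y \<otimes>\<^bsub>free_group S\<^esub> w = \<one>\<^bsub>free_group S\<^esub>"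
    by blast
qed (auto simp: free_group_simps carrier_free_group reduce_reduced)

lemma gen_in_free_group [simp]: "s \<in> S \<Longrightarrow> gen s \<in> carrier (free_group S)"
  by (simp add: carrier_free_group gen_def)

lemma inv_gen: "s \<in> S \<Longrightarrow> inv\<^bsub>free_group S\<^esub> (gen s) = [(s, False)]"
  by (rule group.inv_equality[OF group_free_group])
     (auto simp: free_group_simps gen_def carrier_free_group reduce_def inv_letter_def)

lemma free_lift_Nil [simp]: "free_lift H f [] = \<one>\<^bsub>H\<^esub>"
  by (simp add: free_lift_def)

lemma free_lift_Cons:
  "free_lift H f (x # w) = (if snd x then f (fst x) else inv\<^bsub>H\<^esub> (f (fst x))) \<otimes>\<^bsub>H\<^esub> free_lift H f w"
  by (simp add: free_lift_def split: prod.split)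

context
  fixes H :: "('b, 'c) monoid_scheme" and f :: "'a \<Rightarrow> 'b" and S :: "'a set"
  assumes H: "group H" and f: "f \<in> S \<rightarrow> carrier H"
begin

interpretation H: group H by (rule H)

lemma free_lift_closed: "fst ` set w \<subseteq> S \<Longrightarrow> free_lift H f w \<in> carrier H"
  using f by (induction w) (auto simp: free_lift_Cons Pi_iff)

lemma free_lift_push:
  "fst ` set (x # w) \<subseteq> S \<Longrightarrow> free_lift H f (push_letter x w) = free_lift H f (x # w)"
  using f
  by (cases w)
     (auto simp: free_lift_Cons Pi_iff inv_letter_def free_lift_closed H.m_assoc[symmetric])

lemma free_lift_reduce: "fst ` set w \<subseteq> S \<Longrightarrow> free_lift H f (reduce w) = free_lift H f w"
proof (induction w)
  case (Cons x w)
  have "reduce (x # w) = push_letter x (reduce w)" by (simp add: reduce_def)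
  moreover have "fst ` set (x # reduce w) \<subseteq> S" using Cons.prems set_reduce[of w] by fastforce
  ultimately show ?case
    using Cons free_lift_push by (simp add: free_lift_Cons)
qed (simp add: reduce_def)

lemma free_lift_append:
  "fst ` set (u @ v) \<subseteq> S \<Longrightarrow> free_lift H f (u @ v) = free_lift H f u \<otimes>\<^bsub>H\<^esub> free_lift H f v"
proof (induction u)
  case (Cons x u)
  have "f (fst x) \<in> carrier H" "free_lift H f u \<in> carrier H" "free_lift H f v \<in> carrier H"
    using Cons.prems f by (auto intro!: free_lift_closed)
  with Cons show ?case by (simp add: free_lift_Cons H.m_assoc)
qed (simp add: free_lift_closed)

lemma free_lift_hom: "free_lift H f \<in> hom (free_group S) H"
proof (rule homI)
  fix u v assume "u \<in> carrier (free_group S)" "v \<in> carrier (free_group S)"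
  then have "fst ` set (u @ v) \<subseteq> S" by (auto simp: carrier_free_group)
  then show "free_lift H f (u \<otimes>\<^bsub>free_group S\<^esub> v) = free_lift H f u \<otimes>\<^bsub>H\<^esub> free_lift H f v"
    by (simp only: free_group_simps free_lift_reduce free_lift_append)
qed (simp add: free_lift_closed carrier_free_group)

lemma free_lift_gen: "s \<in> S \<Longrightarrow> free_lift H f (gen s) = f s"
  using f by (auto simp: gen_def free_lift_Cons Pi_iff)

end

lemma free_group_induct [consumes 1, case_names one gen inv]:
  assumes "w \<in> carrier (free_group S)"
    and "P \<one>\<^bsub>free_group S\<^esub>"
    and "\<And>s w. \<lbrakk>s \<in> S; w \<in> carrier (free_group S); P w\<rbrakk> \<Longrightarrow> P (gen s \<otimes>\<^bsub>free_group S\<^esub> w)"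
    and "\<And>s w. \<lbrakk>s \<in> S; w \<in> carrier (free_group S); P w\<rbrakk>
           \<Longrightarrow> P (inv\<^bsub>free_group S\<^esub> (gen s) \<otimes>\<^bsub>free_group S\<^esub> w)"
  shows "P w"
  using assms(1)
proof (induction w)
  case (Cons x w)
  then have w: "w \<in> carrier (free_group S)" and x: "fst x \<in> S" and red: "reduced (x # w)"
    by (auto simp: carrier_free_group dest: reduced_ConsD)
  have *: "x # w = [x] \<otimes>\<^bsub>free_group S\<^esub> w"
    using red by (simp add: free_group_simps reduce_reduced)
  show ?case
  proof (cases "snd x")
    case True
    then have "[x] = gen (fst x)" by (simp add: gen_def prod_eq_iff)
    then show ?thesis using * assms(3)[OF x w] Cons.IH[OF w] by simp
  next
    case False
    then have "[x] = inv\<^bsub>free_group S\<^esub> (gen (fst x))" by (simp add: inv_gen x prod_eq_iff)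
    then show ?thesis using * assms(4)[OF x w] Cons.IH[OF w] by simp
  qed
qed (use assms(2) in \<open>simp add: free_group_simps\<close>)

lemma free_group_hom_eq:
  assumes "group H" "h \<in> hom (free_group S) H" "k \<in> hom (free_group S) H"
    and eq: "\<And>s. s \<in> S \<Longrightarrow> h (gen s) = k (gen s)"
    and w: "w \<in> carrier (free_group S)"
  shows "h w = k w"
proof -
  interpret h: group_hom "free_group S" H h
    using assms group_free_group by (simp add: group_hom_def group_hom_axioms_def)
  interpret k: group_hom "free_group S" H k
    using assms group_free_group by (simp add: group_hom_def group_hom_axioms_def)
  show ?thesis
    using w
  proof (induction w rule: free_group_induct)
    case one
    show ?case by (metis h.hom_one k.hom_one)
  next
    case (gen s w)
    then show ?case
      by (metis eq gen_in_free_group h.hom_mult k.hom_mult)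
  next
    case (inv s w)
    then show ?case
      by (metis eq gen_in_free_group h.G.inv_closed h.hom_inv h.hom_mult k.hom_inv k.hom_mult)
  qed
qed

section \<open>Braid groups\<close>

definition normal_closure :: "('a, 'b) monoid_scheme \<Rightarrow> 'a set \<Rightarrow> 'a set" where
  "normal_closure G R = \<Inter> {N. N \<lhd> G \<and> R \<subseteq> N}"

definition braid_words :: "nat \<Rightarrow> nat letter list monoid" where
  "braid_words n = free_group {1..<n}"

definition braid_relators :: "nat \<Rightarrow> nat letter list set" where
  "braid_relators n = (let W = braid_words n in
     {gen i \<otimes>\<^bsub>W\<^esub> gen j \<otimes>\<^bsub>W\<^esub> inv\<^bsub>W\<^esub> (gen j \<otimes>\<^bsub>W\<^esub> gen i) | i j.
        i \<in> {1..<n} \<and> j \<in> {1..<n} \<and> i + 2 \<le> j} \<union>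
     {gen i \<otimes>\<^bsub>W\<^esub> gen (i+1) \<otimes>\<^bsub>W\<^esub> gen i \<otimes>\<^bsub>W\<^esub> inv\<^bsub>W\<^esub> (gen (i+1) \<otimes>\<^bsub>W\<^esub> gen i \<otimes>\<^bsub>W\<^esub> gen (i+1)) | i.
        i \<in> {1..<n} \<and> i + 1 \<in> {1..<n}})"

definition braid_group :: "nat \<Rightarrow> nat letter list set monoid" where
  "braid_group n = braid_words n Mod normal_closure (braid_words n) (braid_relators n)"

definition artin_gen :: "nat \<Rightarrow> nat \<Rightarrow> nat letter list set" where
  "artin_gen n i = normal_closure (braid_words n) (braid_relators n) #>\<^bsub>braid_words n\<^esub> gen i"

section \<open>The action on the free group\<close>

abbreviation FG :: "nat \<Rightarrow> nat letter list monoid" where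
  "FG n \<equiv> free_group {1..n}"

definition artin_fun :: "nat \<Rightarrow> nat \<Rightarrow> nat \<Rightarrow> nat letter list" where
  "artin_fun n i = (\<lambda>j.
     if j = i then gen (i+1)
     else if j = i+1 then inv\<^bsub>FG n\<^esub> (gen (i+1)) \<otimes>\<^bsub>FG n\<^esub> gen i \<otimes>\<^bsub>FG n\<^esub> gen (i+1)
     else gen j)"

definition artin_aut :: "nat \<Rightarrow> nat \<Rightarrow> nat letter list \<Rightarrow> nat letter list" where
  "artin_aut n i = restrict (free_lift (FG n) (artin_fun n i)) (carrier (FG n))"

text \<open>The product of the automorphism group is composition, rightmost factor first. The
  automorphism attached to a braid is the common value of the lift of the generator
  automorphisms on all the words representing the braid.\<close>

definition braid_action :: "nat \<Rightarrow> nat letter list set \<Rightarrow> nat letter list \<Rightarrow> nat letter list" where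
  "braid_action n \<beta> = the_elem (free_lift (AutoGroup (FG n)) (artin_aut n) ` \<beta>)"

section \<open>Positive cones and order-preserving braids\<close>

definition positive_cone :: "('a, 'b) monoid_scheme \<Rightarrow> 'a set \<Rightarrow> bool" where
  "positive_cone G P \<longleftrightarrow>
     P <#>\<^bsub>G\<^esub> P \<subseteq> P \<and>
     carrier G = P \<union> set_inv\<^bsub>G\<^esub> P \<union> {\<one>\<^bsub>G\<^esub>} \<and>
     P \<inter> set_inv\<^bsub>G\<^esub> P = {} \<and> \<one>\<^bsub>G\<^esub> \<notin> P \<and> \<one>\<^bsub>G\<^esub> \<notin> set_inv\<^bsub>G\<^esub> P \<and>
     (\<forall>g\<in>carrier G. g <#\<^bsub>G\<^esub> P #>\<^bsub>G\<^esub> inv\<^bsub>G\<^esub> g = P)"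

definition order_preserving :: "nat \<Rightarrow> nat letter list set \<Rightarrow> bool" where
  "order_preserving n \<beta> \<longleftrightarrow> (\<exists>P. positive_cone (FG n) P \<and> braid_action n \<beta> ` P = P)"

section \<open>The action is well defined\<close>

lemma normal_closure_normal:
  assumes "group G" "R \<subseteq> carrier G"
  shows "normal_closure G R \<lhd> G"
proof -
  interpret group G by (rule assms(1))
  have *: "carrier G \<lhd> G" using normal_inv_iff subgroup_self by auto
  have "subgroup (normal_closure G R) G"
    unfolding normal_closure_def
    by (rule subgroups_Inter) (use * assms(2) in \<open>auto simp: normal_imp_subgroup\<close>)
  then show ?thesis
    by (auto simp: normal_inv_iff normal_closure_def)
qed

lemma normal_closure_subset: "R \<subseteq> normal_closure G R"
  by (auto simp: normal_closure_def)

lemma normal_closure_least: "N \<lhd> G \<Longrightarrow> R \<subseteq> N \<Longrightarrow> normal_closure G R \<subseteq> N"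
  by (auto simp: normal_closure_def)

lemma group_braid_words: "group (braid_words n)"
  by (simp add: braid_words_def group_free_group)

lemma gen_in_braid_words: "i \<in> {1..<n} \<Longrightarrow> gen i \<in> carrier (braid_words n)"
  by (simp add: braid_words_def)

lemma braid_relators_carrier: "braid_relators n \<subseteq> carrier (braid_words n)"
proof -
  interpret group "braid_words n" by (rule group_braid_words)
  show ?thesis
    by (auto simp: braid_relators_def Let_def gen_in_braid_words)
qed

lemma normal_braid:
  "normal_closure (braid_words n) (braid_relators n) \<lhd> braid_words n"
  by (rule normal_closure_normal[OF group_braid_words braid_relators_carrier])

lemma group_braid_group: "group (braid_group n)"
  unfolding braid_group_def by (rule normal.factorgroup_is_group[OF normal_braid])

lemma artin_gen_in_braid_group: "i \<in> {1..<n} \<Longrightarrow> artin_gen n i \<in> carrier (braid_group n)"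
  by (auto simp: braid_group_def artin_gen_def carrier_FactGroup gen_in_braid_words)

definition artin_inv_fun :: "nat \<Rightarrow> nat \<Rightarrow> nat \<Rightarrow> nat letter list" where
  "artin_inv_fun n i = (\<lambda>j.
     if j = i then gen i \<otimes>\<^bsub>FG n\<^esub> gen (i+1) \<otimes>\<^bsub>FG n\<^esub> inv\<^bsub>FG n\<^esub> (gen i)
     else if j = i+1 then gen i
     else gen j)"

lemma artin_fun_simps:
  "artin_fun n i i = gen (i+1)"
  "artin_fun n i (i+1) = inv\<^bsub>FG n\<^esub> (gen (i+1)) \<otimes>\<^bsub>FG n\<^esub> gen i \<otimes>\<^bsub>FG n\<^esub> gen (i+1)"
  "j \<noteq> i \<Longrightarrow> j \<noteq> i+1 \<Longrightarrow> artin_fun n i j = gen j"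
  by (simp_all add: artin_fun_def)

lemma artin_inv_fun_simps:
  "artin_inv_fun n i i = gen i \<otimes>\<^bsub>FG n\<^esub> gen (i+1) \<otimes>\<^bsub>FG n\<^esub> inv\<^bsub>FG n\<^esub> (gen i)"
  "artin_inv_fun n i (i+1) = gen i"
  "j \<noteq> i \<Longrightarrow> j \<noteq> i+1 \<Longrightarrow> artin_inv_fun n i j = gen j"
  by (simp_all add: artin_inv_fun_def)

context
  notes One_nat_def [simp del]
  fixes n i :: nat
  assumes i: "i \<in> {1..<n}"
begin

interpretation group "FG n" by (rule group_free_group)

lemma artin_fun_closed: "artin_fun n i \<in> {1..n} \<rightarrow> carrier (FG n)"
  using i by (auto simp: artin_fun_def)

lemma artin_inv_fun_closed: "artin_inv_fun n i \<in> {1..n} \<rightarrow> carrier (FG n)"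
  using i by (auto simp: artin_inv_fun_def)

lemma inv_cancel:
  "\<lbrakk>x \<in> carrier (FG n); y \<in> carrier (FG n)\<rbrakk> \<Longrightarrow> x \<otimes>\<^bsub>FG n\<^esub> (inv\<^bsub>FG n\<^esub> x \<otimes>\<^bsub>FG n\<^esub> y) = y"
  "\<lbrakk>x \<in> carrier (FG n); y \<in> carrier (FG n)\<rbrakk> \<Longrightarrow> inv\<^bsub>FG n\<^esub> x \<otimes>\<^bsub>FG n\<^esub> (x \<otimes>\<^bsub>FG n\<^esub> y) = y"
  by (simp_all flip: m_assoc)

lemma artin_inverse:
  assumes "w \<in> carrier (FG n)"
  shows "free_lift (FG n) (artin_fun n i) (free_lift (FG n) (artin_inv_fun n i) w) = w"
    and "free_lift (FG n) (artin_inv_fun n i) (free_lift (FG n) (artin_fun n i) w) = w"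
proof -
  let ?a = "free_lift (FG n) (artin_fun n i)" and ?b = "free_lift (FG n) (artin_inv_fun n i)"
  have a: "?a \<in> hom (FG n) (FG n)" and b: "?b \<in> hom (FG n) (FG n)"
    by (rule free_lift_hom[OF is_group artin_fun_closed],
        rule free_lift_hom[OF is_group artin_inv_fun_closed])
  interpret a: group_hom "FG n" "FG n" ?a by unfold_locales (rule a)
  interpret b: group_hom "FG n" "FG n" ?b by unfold_locales (rule b)
  note ag = free_lift_gen[OF is_group artin_fun_closed]
  note bg = free_lift_gen[OF is_group artin_inv_fun_closed]
  have id: "id \<in> hom (FG n) (FG n)" by (simp add: hom_def Pi_iff)
  have "(?a \<circ> ?b) w = id w"
  proof (rule free_group_hom_eq[OF is_group _ id _ assms])
    show "?a \<circ> ?b \<in> hom (FG n) (FG n)" by (rule Group.hom_compose[OF b a])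
    fix s assume "s \<in> {1..n}"
    then show "(?a \<circ> ?b) (gen s) = id (gen s)"
      using i
      by (cases "s = i"; cases "s = i + 1")
         (auto simp: ag bg artin_fun_simps artin_inv_fun_simps m_assoc inv_cancel)
  qed
  then show "?a (?b w) = w" by simp
  have "(?b \<circ> ?a) w = id w"
  proof (rule free_group_hom_eq[OF is_group _ id _ assms])
    show "?b \<circ> ?a \<in> hom (FG n) (FG n)" by (rule Group.hom_compose[OF a b])
    fix s assume "s \<in> {1..n}"
    then show "(?b \<circ> ?a) (gen s) = id (gen s)"
      using i
      by (cases "s = i"; cases "s = i + 1")
         (auto simp: ag bg artin_fun_simps artin_inv_fun_simps m_assoc inv_cancel)
  qed
  then show "?b (?a w) = w" by simp
qed

lemma artin_aut_auto: "artin_aut n i \<in> carrier (AutoGroup (FG n))"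
proof -
  have a: "free_lift (FG n) (artin_fun n i) \<in> hom (FG n) (FG n)"
    by (rule free_lift_hom[OF is_group artin_fun_closed])
  have b: "free_lift (FG n) (artin_inv_fun n i) \<in> hom (FG n) (FG n)"
    by (rule free_lift_hom[OF is_group artin_inv_fun_closed])
  have "bij_betw (free_lift (FG n) (artin_fun n i)) (carrier (FG n)) (carrier (FG n))"
    by (rule bij_betwI[where g = "free_lift (FG n) (artin_inv_fun n i)"])
       (use a b artin_inverse in \<open>auto simp: hom_def\<close>)
  then have "artin_aut n i \<in> Bij (carrier (FG n))"
    by (simp add: Bij_def artin_aut_def cong: bij_betw_cong)
  moreover have "artin_aut n i \<in> hom (FG n) (FG n)"
    using a by (auto simp: artin_aut_def hom_def Pi_iff)
  ultimately show ?thesis by (simp add: AutoGroup_def auto_def)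
qed

lemma artin_aut_gen:
  assumes "j \<in> {1..n}"
  shows "artin_aut n i (gen j) = artin_fun n i j"
  using assms free_lift_gen[OF is_group artin_fun_closed assms] by (simp add: artin_aut_def)

end

lemma AutoGroup_mult:
  assumes "f \<in> carrier (AutoGroup G)" "g \<in> carrier (AutoGroup G)" "x \<in> carrier G"
  shows "(f \<otimes>\<^bsub>AutoGroup G\<^esub> g) x = f (g x)"
  using assms by (simp add: AutoGroup_def BijGroup_def auto_def compose_def)

lemma auto_eqI:
  assumes f: "f \<in> carrier (AutoGroup (free_group S))" and g: "g \<in> carrier (AutoGroup (free_group S))"
    and eq: "\<And>s. s \<in> S \<Longrightarrow> f (gen s) = g (gen s)"
  shows "f = g"
proof (rule extensionalityI[where A = "carrier (free_group S)"])
  show "f \<in> extensional (carrier (free_group S))" "g \<in> extensional (carrier (free_group S))"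
    using f g by (auto simp: AutoGroup_def auto_def Bij_def)
  show "f x = g x" if "x \<in> carrier (free_group S)" for x
  proof (rule free_group_hom_eq[where S = S and H = "free_group S" and h = f and k = g])
    show "f \<in> hom (free_group S) (free_group S)" "g \<in> hom (free_group S) (free_group S)"
      using f g by (auto simp: AutoGroup_def auto_def)
  qed (use eq that group_free_group in auto)
qed

context
  notes One_nat_def [simp del]
  fixes n i j :: nat
  assumes i: "i \<in> {1..<n}" and j: "j \<in> {1..<n}"
begin

interpretation group "FG n" by (rule group_free_group)
interpretation A: group "AutoGroup (FG n)" by (rule AutoGroup)
interpretation i: group_hom "FG n" "FG n" "artin_aut n i"
  using artin_aut_auto[OF i] by unfold_locales (simp add: AutoGroup_def auto_def)
interpretation j: group_hom "FG n" "FG n" "artin_aut n j"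
  using artin_aut_auto[OF j] by unfold_locales (simp add: AutoGroup_def auto_def)

lemma artin_aut_commute:
  assumes "i + 2 \<le> j"
  shows "artin_aut n i \<otimes>\<^bsub>AutoGroup (FG n)\<^esub> artin_aut n j
       = artin_aut n j \<otimes>\<^bsub>AutoGroup (FG n)\<^esub> artin_aut n i" (is "?l = ?r")
proof (rule auto_eqI)
  fix s assume "s \<in> {1..n}"
  then show "?l (gen s) = ?r (gen s)"
    using i j assms
    by (auto simp: AutoGroup_mult artin_aut_auto artin_aut_gen artin_fun_def)
qed (auto intro!: A.m_closed artin_aut_auto i j)

lemma artin_aut_braid:
  assumes "j = i + 1"
  shows "artin_aut n i \<otimes>\<^bsub>AutoGroup (FG n)\<^esub> artin_aut n j \<otimes>\<^bsub>AutoGroup (FG n)\<^esub> artin_aut n i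
       = artin_aut n j \<otimes>\<^bsub>AutoGroup (FG n)\<^esub> artin_aut n i \<otimes>\<^bsub>AutoGroup (FG n)\<^esub> artin_aut n j"
    (is "?l = ?r")
proof (rule auto_eqI)
  fix s assume s: "s \<in> {1..n}"
  have mult: "(f \<otimes>\<^bsub>AutoGroup (FG n)\<^esub> g \<otimes>\<^bsub>AutoGroup (FG n)\<^esub> h) x = f (g (h x))"
    if "f \<in> carrier (AutoGroup (FG n))" "g \<in> carrier (AutoGroup (FG n))"
       "h \<in> carrier (AutoGroup (FG n))" "x \<in> carrier (FG n)" "h x \<in> carrier (FG n)" for f g h x
    using that by (simp add: AutoGroup_mult)
  define p q r where "p = gen i" and "q = gen j" and "r = gen (j + 1)"
  have c: "p \<in> carrier (FG n)" "q \<in> carrier (FG n)" "r \<in> carrier (FG n)"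
    using i j by (auto simp: p_def q_def r_def)
  have ri: "artin_aut n i p = q" "artin_aut n i q = inv\<^bsub>FG n\<^esub> q \<otimes>\<^bsub>FG n\<^esub> p \<otimes>\<^bsub>FG n\<^esub> q" "artin_aut n i r = r"
    using i j assms by (auto simp: p_def q_def r_def artin_aut_gen[OF i] artin_fun_def)
  have rj: "artin_aut n j p = p" "artin_aut n j q = r" "artin_aut n j r = inv\<^bsub>FG n\<^esub> r \<otimes>\<^bsub>FG n\<^esub> q \<otimes>\<^bsub>FG n\<^esub> r"
    using i j artin_aut_gen[OF j] assms by (auto simp: p_def q_def r_def artin_fun_def)
  have lr: "?l x = artin_aut n i (artin_aut n j (artin_aut n i x))"
    "?r x = artin_aut n j (artin_aut n i (artin_aut n j x))" if "x \<in> carrier (FG n)" for x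
    using that by (auto intro!: mult artin_aut_auto i j)
  consider "s = i" | "s = j" | "s = j + 1" | "s \<noteq> i" "s \<noteq> j" "s \<noteq> j + 1" by blast
  then show "?l (gen s) = ?r (gen s)"
  proof cases
    case 1
    have "?l p = ?r p" unfolding lr[OF c(1)] ri rj ..
    then show ?thesis using 1 by (simp add: p_def)
  next
    case 2
    have "?l q = ?r q" unfolding lr[OF c(2)] by (simp add: ri rj c)
    then show ?thesis using 2 by (simp add: q_def)
  next
    case 3
    have "?l r = ?r r"
      unfolding lr[OF c(3)] by (simp add: ri rj c m_assoc inv_mult_group inv_cancel[OF i])
    then show ?thesis using 3 by (simp add: r_def)
  next
    case 4
    then have "artin_aut n i (gen s) = gen s" "artin_aut n j (gen s) = gen s"
      using s assms artin_aut_gen[OF i s] artin_aut_gen[OF j s] by (auto simp: artin_fun_def)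
    then show ?thesis using s by (simp add: lr)
  qed
qed (auto intro!: A.m_closed artin_aut_auto i j)

end

context
  notes One_nat_def [simp del]
begin

abbreviation word_action :: "nat \<Rightarrow> nat letter list \<Rightarrow> nat letter list \<Rightarrow> nat letter list" where
  "word_action n \<equiv> free_lift (AutoGroup (FG n)) (artin_aut n)"

lemma word_action_group_hom: "group_hom (braid_words n) (AutoGroup (FG n)) (word_action n)"
proof -
  have "group (AutoGroup (FG n))" by (rule group.AutoGroup[OF group_free_group])
  moreover have "word_action n \<in> hom (braid_words n) (AutoGroup (FG n))"
    unfolding braid_words_def
    by (rule free_lift_hom) (use calculation artin_aut_auto in auto)
  ultimately show ?thesis
    by (simp add: group_hom_def group_hom_axioms_def group_braid_words)
qed

lemma word_action_gen: "i \<in> {1..<n} \<Longrightarrow> word_action n (gen i) = artin_aut n i"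
  by (rule free_lift_gen[where S = "{1..<n}"])
     (auto intro: group.AutoGroup group_free_group artin_aut_auto)

lemma word_action_relators: "braid_relators n \<subseteq> kernel (braid_words n) (AutoGroup (FG n)) (word_action n)"
proof -
  interpret h: group_hom "braid_words n" "AutoGroup (FG n)" "word_action n"
    by (rule word_action_group_hom)
  have *: "word_action n (u \<otimes>\<^bsub>braid_words n\<^esub> inv\<^bsub>braid_words n\<^esub> v) = \<one>\<^bsub>AutoGroup (FG n)\<^esub>"
    if "u \<in> carrier (braid_words n)" "v \<in> carrier (braid_words n)" "word_action n u = word_action n v" for u v
    using that by simp
  have "word_action n r = \<one>\<^bsub>AutoGroup (FG n)\<^esub>" if "r \<in> braid_relators n" for r
    using that unfolding braid_relators_def Let_def
  proof (elim UnE CollectE exE conjE)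
    fix i j assume ij: "i \<in> {1..<n}" "j \<in> {1..<n}" "i + 2 \<le> j"
      and r: "r = gen i \<otimes>\<^bsub>braid_words n\<^esub> gen j \<otimes>\<^bsub>braid_words n\<^esub> inv\<^bsub>braid_words n\<^esub> (gen j \<otimes>\<^bsub>braid_words n\<^esub> gen i)"
    note g = gen_in_braid_words[OF ij(1)] gen_in_braid_words[OF ij(2)]
    show ?thesis unfolding r
      by (rule *) (simp_all only: g h.G.m_closed h.hom_mult word_action_gen[OF ij(1)]
          word_action_gen[OF ij(2)] artin_aut_commute[OF ij])
  next
    fix i assume i: "i \<in> {1..<n}" "i + 1 \<in> {1..<n}"
      and r: "r = gen i \<otimes>\<^bsub>braid_words n\<^esub> gen (i+1) \<otimes>\<^bsub>braid_words n\<^esub> gen i \<otimes>\<^bsub>braid_words n\<^esub> inv\<^bsub>braid_words n\<^esub> (gen (i+1) \<otimes>\<^bsub>braid_words n\<^esub> gen i \<otimes>\<^bsub>braid_words n\<^esub> gen (i+1))"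
    note g = gen_in_braid_words[OF i(1)] gen_in_braid_words[OF i(2)]
    show ?thesis unfolding r
      by (rule *) (simp_all only: g h.G.m_closed h.hom_mult word_action_gen[OF i(1)]
          word_action_gen[OF i(2)] artin_aut_braid[OF i refl])
  qed
  then show ?thesis
    using braid_relators_carrier by (auto simp: kernel_def)
qed

lemma braid_action_coset:
  assumes w: "w \<in> carrier (braid_words n)"
  shows "braid_action n (normal_closure (braid_words n) (braid_relators n) #>\<^bsub>braid_words n\<^esub> w)
       = word_action n w"
proof -
  interpret h: group_hom "braid_words n" "AutoGroup (FG n)" "word_action n"
    by (rule word_action_group_hom)
  let ?N = "normal_closure (braid_words n) (braid_relators n)"
  have N: "?N \<subseteq> kernel (braid_words n) (AutoGroup (FG n)) (word_action n)"
    by (rule normal_closure_least[OF h.normal_kernel word_action_relators])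
  interpret N: normal ?N "braid_words n" by (rule normal_braid)
  have "word_action n v = word_action n w" if "v \<in> ?N #>\<^bsub>braid_words n\<^esub> w" for v
  proof -
    obtain x where x: "x \<in> ?N" and v: "v = x \<otimes>\<^bsub>braid_words n\<^esub> w"
      using \<open>v \<in> _\<close> by (auto simp: r_coset_def)
    have "x \<in> carrier (braid_words n)" "word_action n x = \<one>\<^bsub>AutoGroup (FG n)\<^esub>"
      using x N by (auto simp: kernel_def)
    then show ?thesis using w by (simp only: v h.hom_mult h.H.l_one h.hom_closed)
  qed
  moreover have "w \<in> ?N #>\<^bsub>braid_words n\<^esub> w"
    using w by (rule h.G.rcos_self[OF _ N.is_subgroup])
  ultimately have "word_action n ` (?N #>\<^bsub>braid_words n\<^esub> w) = {word_action n w}"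
    by blast
  then show ?thesis by (simp add: braid_action_def)
qed

theorem braid_action_hom: "braid_action n \<in> hom (braid_group n) (AutoGroup (FG n))"
proof (rule homI)
  interpret h: group_hom "braid_words n" "AutoGroup (FG n)" "word_action n"
    by (rule word_action_group_hom)
  interpret N: normal "normal_closure (braid_words n) (braid_relators n)" "braid_words n"
    by (rule normal_braid)
  fix a assume "a \<in> carrier (braid_group n)"
  then show "braid_action n a \<in> carrier (AutoGroup (FG n))"
    by (auto simp: braid_group_def carrier_FactGroup braid_action_coset)
next
  interpret h: group_hom "braid_words n" "AutoGroup (FG n)" "word_action n"
    by (rule word_action_group_hom)
  interpret N: normal "normal_closure (braid_words n) (braid_relators n)" "braid_words n"
    by (rule normal_braid)
  fix a b assume "a \<in> carrier (braid_group n)" "b \<in> carrier (braid_group n)"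
  then show "braid_action n (a \<otimes>\<^bsub>braid_group n\<^esub> b)
      = braid_action n a \<otimes>\<^bsub>AutoGroup (FG n)\<^esub> braid_action n b"
    by (auto simp: braid_group_def carrier_FactGroup braid_action_coset N.rcos_sum)
qed

theorem braid_action_artin_gen:
  assumes "i \<in> {1..<n}"
  shows "braid_action n (artin_gen n i) = artin_aut n i"
  by (simp only: artin_gen_def braid_action_coset[OF gen_in_braid_words[OF assms]]
      word_action_gen[OF assms])

end

end

theory Submission
  imports Defs
begin

text \<open>Write a, b, c for the generators of the free group, A for the conjugate of a by b, and
  d = A c. Since the square of the second Artin generator acts on b and c as conjugation by b c, and
  the first generator maps b c to d, the braid sends a to b, b to y, c to the conjugate of u by y,
  and A to the conjugate of b by y, where u and y are the conjugates of A and c by the m-th power of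
  d, so that d = u y.
  Suppose a bi-invariant order preserved by the braid has a < b; the reversed order covers the other
  case. Applying the braid to a < b gives A < b < y. Were c \<open>\<le>\<close> A, then y \<open>\<le>\<close> u, and
  u y > A A \<open>\<ge>\<close> A c would contradict u y = A c; so A < c, whence u < y, and, by applying the braid,
  b < u. Applying the braid to b < u and b < y, the image of u y = d exceeds y y; but this image is
  the conjugate of b u by y, and b u < y y.\<close>

text \<open>After rebracketing by \<open>m_assoc\<close>, an adjacent inverse pair may be followed
  by a further factor; these rules cancel it there, so that \<open>simp\<close> can normalise group
  words.\<close>

lemma (in group) mult_inv_cancel:
  assumes "x \<in> carrier G" "y \<in> carrier G"
  shows "x \<otimes> (inv x \<otimes> y) = y" "inv x \<otimes> (x \<otimes> y) = y"
  using assms by (simp_all flip: m_assoc)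

locale bi_ordered_group = group G for G (structure) +
  fixes less :: "'a \<Rightarrow> 'a \<Rightarrow> bool" (infix \<open>\<prec>\<close> 50)
  assumes irrefl: "x \<in> carrier G \<Longrightarrow> \<not> x \<prec> x"
    and trans: "\<lbrakk>x \<in> carrier G; y \<in> carrier G; z \<in> carrier G; x \<prec> y; y \<prec> z\<rbrakk> \<Longrightarrow> x \<prec> z"
    and total: "\<lbrakk>x \<in> carrier G; y \<in> carrier G; x \<noteq> y\<rbrakk> \<Longrightarrow> x \<prec> y \<or> y \<prec> x"
    and mult_left: "\<lbrakk>x \<in> carrier G; y \<in> carrier G; g \<in> carrier G; x \<prec> y\<rbrakk> \<Longrightarrow> g \<otimes> x \<prec> g \<otimes> y"
    and mult_right: "\<lbrakk>x \<in> carrier G; y \<in> carrier G; g \<in> carrier G; x \<prec> y\<rbrakk> \<Longrightarrow> x \<otimes> g \<prec> y \<otimes> g"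
begin

lemma mult_strict_mono:
  assumes "x \<in> carrier G" "y \<in> carrier G" "z \<in> carrier G" "w \<in> carrier G" "x \<prec> y" "z \<prec> w"
  shows "x \<otimes> z \<prec> y \<otimes> w"
  using assms by (meson m_closed mult_left mult_right trans)

lemma conj_mono:
  assumes "x \<in> carrier G" "y \<in> carrier G" "g \<in> carrier G" "x \<prec> y"
  shows "inv g \<otimes> x \<otimes> g \<prec> inv g \<otimes> y \<otimes> g"
  using assms by (simp add: mult_left mult_right)

text \<open>Conjugation by \<open>g\<close> is undone by conjugation by its inverse, which is
  monotone too. Common conjugators can therefore be stripped from a comparison.\<close>

lemma conj_less_iff:
  assumes "x \<in> carrier G" "y \<in> carrier G" "g \<in> carrier G"
  shows "inv g \<otimes> x \<otimes> g \<prec> inv g \<otimes> y \<otimes> g \<longleftrightarrow> x \<prec> y"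
proof
  assume "inv g \<otimes> x \<otimes> g \<prec> inv g \<otimes> y \<otimes> g"
  then have "g \<otimes> (inv g \<otimes> x \<otimes> g) \<otimes> inv g \<prec> g \<otimes> (inv g \<otimes> y \<otimes> g) \<otimes> inv g"
    using assms by (simp add: mult_left mult_right)
  moreover have "g \<otimes> (inv g \<otimes> z \<otimes> g) \<otimes> inv g = z" if "z \<in> carrier G" for z
    using that assms by (simp add: m_assoc mult_inv_cancel)
  ultimately show "x \<prec> y" using assms by simp
qed (rule conj_mono[OF assms])

lemma dual: "bi_ordered_group G (\<lambda>x y. y \<prec> x)"
proof
  show "z \<prec> x" if "x \<in> carrier G" "y \<in> carrier G" "z \<in> carrier G" "y \<prec> x" "z \<prec> y" for x y z
    using trans[of z y x] that by simp
  show "y \<prec> x \<or> x \<prec> y" if "x \<in> carrier G" "y \<in> carrier G" "x \<noteq> y" for x y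
    using total that by blast
qed (simp_all add: irrefl mult_left mult_right)

text \<open>The order-theoretic core, with \<open>k\<close> in the role of \<open>m\<close>.
  Freeness does not enter: only the values of \<open>\<beta>\<close> at \<open>a\<close>,
  \<open>b\<close>, \<open>c\<close> do. All hypotheses carry over to the reversed order, so the
  same statement also excludes \<open>b\<close> below \<open>a\<close>.\<close>

lemma no_order_preserving_map:
  fixes \<beta> :: "'a \<Rightarrow> 'a" and k :: int
  assumes hom: "\<beta> \<in> hom G G"
    and mono: "\<And>x y. \<lbrakk>x \<in> carrier G; y \<in> carrier G; x \<prec> y\<rbrakk> \<Longrightarrow> \<beta> x \<prec> \<beta> y"
    and carr [simp]: "a \<in> carrier G" "b \<in> carrier G" "c \<in> carrier G"
    and d: "d = inv b \<otimes> a \<otimes> b \<otimes> c"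
    and \<beta>: "\<beta> a = b" "\<beta> b = inv (d [^] k) \<otimes> c \<otimes> d [^] k"
      "\<beta> c = inv (d [^] k) \<otimes> (inv c \<otimes> (inv b \<otimes> a \<otimes> b) \<otimes> c) \<otimes> d [^] k"
  shows "\<not> a \<prec> b"
proof
  assume ab: "a \<prec> b"
  interpret \<beta>: group_hom G G \<beta> by unfold_locales (rule hom)
  define A where "A = inv b \<otimes> a \<otimes> b"
  define g where "g = d [^] k"
  define y where "y = inv g \<otimes> c \<otimes> g"
  define u where "u = inv g \<otimes> A \<otimes> g"
  have dA: "d = A \<otimes> c" by (simp add: d A_def)
  have cl [simp]: "A \<in> carrier G" "d \<in> carrier G" "g \<in> carrier G" "y \<in> carrier G" "u \<in> carrier G"
    by (simp_all add: A_def d g_def y_def u_def)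
  \<comment> \<open>Powers of \<open>d\<close> commute with \<open>d\<close>. Conjugating the
    factors of \<open>d = A c\<close> by \<open>g\<close> then gives \<open>u y = d\<close>.\<close>
  have dg: "inv g \<otimes> d \<otimes> g = d"
  proof -
    have "d \<otimes> g = g \<otimes> d"
      by (simp add: g_def) (metis cl(2) int_pow_1 int_pow_mult add.commute)
    then show ?thesis by (simp add: m_assoc mult_inv_cancel)
  qed
  then have uy: "u \<otimes> y = d"
    by (simp add: u_def y_def dA m_assoc mult_inv_cancel)
  have \<beta>b: "\<beta> b = y" by (simp add: \<beta> y_def g_def)
  \<comment> \<open>Conjugation by \<open>g\<close> is multiplicative, so it turns the conjugate of
    \<open>A\<close> by \<open>c\<close> into the conjugate of \<open>u\<close> by
    \<open>y\<close>.\<close>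
  have \<beta>c: "\<beta> c = inv y \<otimes> u \<otimes> y"
    unfolding \<beta>(3) A_def[symmetric] g_def[symmetric]
    by (simp add: y_def u_def m_assoc mult_inv_cancel inv_mult_group)
  have \<beta>A: "\<beta> A = inv y \<otimes> b \<otimes> y" by (simp add: A_def \<beta>(1) \<beta>b)
  have by': "b \<prec> y" using mono[OF _ _ ab] \<beta>(1) \<beta>b by simp
  \<comment> \<open>Conjugation by \<open>b\<close> turns \<open>a\<close> into \<open>A\<close> and
    fixes \<open>b\<close>.\<close>
  have Ab: "A \<prec> b"
    using conj_mono[OF _ _ _ ab, of b] by (simp add: A_def)
  have Ay: "A \<prec> y" using trans[OF _ _ _ Ab by'] by simp
  have Ac: "A \<prec> c"
  proof (rule ccontr)
    assume "\<not> A \<prec> c"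
    then consider "A = c" | "c \<prec> A" using total[of A c] by auto
    then show False
    proof cases
      case 1
      \<comment> \<open>If \<open>A = c\<close> then also \<open>u = y\<close>, so \<open>A\<close>
        lies below both factors.\<close>
      then have "A \<otimes> A \<prec> u \<otimes> y"
        using mult_strict_mono[of A u A y] Ay by (simp add: u_def y_def)
      then show False using 1 irrefl[of d] by (simp add: uy dA)
    next
      case 2
      then have "y \<prec> u" by (simp add: y_def u_def conj_mono)
      then have "A \<prec> u" using Ay trans[of A y u] by simp
      then have "A \<otimes> A \<prec> d" using mult_strict_mono[of A u A y] Ay by (simp add: uy)
      moreover have "d \<prec> A \<otimes> A" using 2 by (simp add: dA mult_left)
      ultimately show False using irrefl[of d] trans[of d "A \<otimes> A" d] by simp
    qed
  qed
  then have "u \<prec> y" by (simp add: y_def u_def conj_mono)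
  \<comment> \<open>\<open>\<beta> A\<close> and \<open>\<beta> c\<close> are the conjugates of
    \<open>b\<close> and \<open>u\<close> by the same element \<open>y\<close>.\<close>
  have bu: "b \<prec> u"
    using mono[OF _ _ Ac] by (simp add: \<beta>A \<beta>c conj_less_iff)
  have "y \<prec> \<beta> u" "y \<prec> \<beta> y"
    using mono[OF _ _ bu] mono[OF _ _ by'] by (simp_all add: \<beta>b)
  then have "y \<otimes> y \<prec> \<beta> (u \<otimes> y)" by (simp add: mult_strict_mono)
  also have "\<beta> (u \<otimes> y) = inv y \<otimes> (b \<otimes> u) \<otimes> y"
    by (simp add: uy dA \<beta>A \<beta>c m_assoc mult_inv_cancel)
  \<comment> \<open>\<open>y y\<close> is its own conjugate by \<open>y\<close>, so both sides
    become conjugates by \<open>y\<close>.\<close>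
  finally have "inv y \<otimes> (y \<otimes> y) \<otimes> y \<prec> inv y \<otimes> (b \<otimes> u) \<otimes> y" by (simp add: mult_inv_cancel)
  then have "y \<otimes> y \<prec> b \<otimes> u" by (simp add: conj_less_iff)
  moreover have "b \<otimes> u \<prec> y \<otimes> y" using by' \<open>u \<prec> y\<close> by (simp add: mult_strict_mono)
  ultimately show False using irrefl[of "y \<otimes> y"] trans[of "y \<otimes> y" "b \<otimes> u" "y \<otimes> y"] by simp
qed

end

text \<open>Closure of \<open>P\<close> under products gives transitivity. A left factor
  \<open>g\<close> cancels in \<open>inv x \<otimes> y\<close>, while a right factor conjugates this
  element, which stays in \<open>P\<close> by conjugation invariance.\<close>

lemma (in group) bi_ordered_group_positive_cone:
  assumes P: "positive_cone G P"
  shows "bi_ordered_group G (\<lambda>x y. inv x \<otimes> y \<in> P)"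
proof
  have one: "\<one> \<notin> P" and PG: "P \<subseteq> carrier G"
    using P unfolding positive_cone_def by blast+
  have mult: "x \<otimes> y \<in> P" if "x \<in> P" "y \<in> P" for x y
    using P that unfolding positive_cone_def set_mult_def by blast
  have conj: "g \<otimes> x \<otimes> inv g \<in> P" if "x \<in> P" "g \<in> carrier G" for x g
    using P that unfolding positive_cone_def l_coset_def r_coset_def by blast
  have total: "x \<in> P \<or> inv x \<in> P \<or> x = \<one>" if "x \<in> carrier G" for x
  proof -
    have "x \<in> P \<union> set_inv P \<union> {\<one>}" using P that by (simp add: positive_cone_def)
    then show ?thesis using PG by (auto simp: SET_INV_def subset_iff)
  qed
  show "inv x \<otimes> x \<notin> P" if "x \<in> carrier G" for x
    using that one by simp
  show "inv x \<otimes> z \<in> P" if "x \<in> carrier G" "y \<in> carrier G" "z \<in> carrier G"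
    "inv x \<otimes> y \<in> P" "inv y \<otimes> z \<in> P" for x y z
    using mult[OF that(4,5)] that by (simp add: m_assoc mult_inv_cancel)
  \<comment> \<open>The third possibility, \<open>inv x \<otimes> y = \<one>\<close>, would force
    \<open>x = y\<close>.\<close>
  show "inv x \<otimes> y \<in> P \<or> inv y \<otimes> x \<in> P" if "x \<in> carrier G" "y \<in> carrier G" "x \<noteq> y" for x y
    using total[of "inv x \<otimes> y"] that inv_solve_left[of \<one> x y] by (auto simp: inv_mult_group)
  show "inv (g \<otimes> x) \<otimes> (g \<otimes> y) \<in> P"
    if "x \<in> carrier G" "y \<in> carrier G" "g \<in> carrier G" "inv x \<otimes> y \<in> P" for x y g
    using that by (simp add: inv_mult_group m_assoc mult_inv_cancel)
  show "inv (x \<otimes> g) \<otimes> (y \<otimes> g) \<in> P"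
    if "x \<in> carrier G" "y \<in> carrier G" "g \<in> carrier G" "inv x \<otimes> y \<in> P" for x y g
    using conj[OF that(4), of "inv g"] that by (simp add: inv_mult_group m_assoc)
qed

lemma (in group) AutoGroup_hom: "f \<in> carrier (AutoGroup G) \<Longrightarrow> group_hom G G f"
  by unfold_locales (simp add: AutoGroup_def auto_def)

text \<open>Since \<open>\<rho>\<close> fixes \<open>q\<close>, applying it to a conjugate of
  \<open>x\<close> by a power of \<open>q\<close> raises that power by one. This will handle the
  even part of the exponent \<open>2 * m + 1\<close>.\<close>

lemma (in group) AutoGroup_int_pow_conj:
  fixes k :: int
  assumes \<rho>: "\<rho> \<in> carrier (AutoGroup G)" and carr [simp]: "q \<in> carrier G" "x \<in> carrier G"
    and fix_q: "\<rho> q = q" and conj: "\<rho> x = inv q \<otimes> x \<otimes> q"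
  shows "(\<rho> [^]\<^bsub>AutoGroup G\<^esub> k) x = inv (q [^] k) \<otimes> x \<otimes> q [^] k"
proof -
  interpret A: group "AutoGroup G" by (rule AutoGroup)
  interpret \<rho>: group_hom G G \<rho> by (rule AutoGroup_hom[OF \<rho>])
  have inj: "inj_on \<rho> (carrier G)"
    using \<rho> by (simp add: AutoGroup_def auto_def Bij_def bij_betw_def)
  have step: "(\<rho> [^]\<^bsub>AutoGroup G\<^esub> (k + 1)) x = \<rho> ((\<rho> [^]\<^bsub>AutoGroup G\<^esub> k) x)" for k :: int
    using A.int_pow_mult[OF \<rho>, of 1 k] \<rho>
    by (simp add: AutoGroup_mult add.commute)
  have q: "q [^] (k + 1) = q [^] k \<otimes> q" "q [^] (k + 1) = q \<otimes> q [^] k" for k :: int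
    using int_pow_mult[of q k 1] int_pow_mult[of q 1 k] by (simp_all add: add.commute)
  have \<rho>q: "\<rho> (q [^] k) = q [^] k" for k :: int
    by (simp add: \<rho>.hom_int_pow fix_q)
  \<comment> \<open>The new factor \<open>q\<close> arises next to \<open>x\<close>, hence the
    expansion with \<open>q\<close> on the left of \<open>q [^] k\<close>.\<close>
  have \<rho>_conj: "\<rho> (inv (q [^] k) \<otimes> x \<otimes> q [^] k) = inv (q [^] (k + 1)) \<otimes> x \<otimes> q [^] (k + 1)" for k :: int
    by (subst q(2), subst q(2)) (simp add: \<rho>q conj inv_mult_group m_assoc)
  show ?thesis
  proof (induction k rule: int_induct[where k = 0])
    case base
    show ?case by (simp add: AutoGroup_def BijGroup_def)
  next
    case (step1 i)
    then show ?case by (simp add: step \<rho>_conj)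
  next
    \<comment> \<open>For the downward step, \<open>\<rho>\<close> is applied to both sides at
      \<open>i - 1\<close>; the induction hypothesis at \<open>i\<close> identifies the results, and
      injectivity of \<open>\<rho>\<close> removes it again.\<close>
    case (step2 i)
    have cl: "(\<rho> [^]\<^bsub>AutoGroup G\<^esub> (i - 1)) x \<in> carrier G"
      by (rule group_hom.hom_closed[OF AutoGroup_hom[OF A.int_pow_closed[OF \<rho>]] carr(2)])
    have "\<rho> ((\<rho> [^]\<^bsub>AutoGroup G\<^esub> (i - 1)) x) = \<rho> (inv (q [^] (i - 1)) \<otimes> x \<otimes> q [^] (i - 1))"
      using step[of "i - 1"] step2 \<rho>_conj[of "i - 1"] by simp
    then show ?case by (rule inj_onD[OF inj]) (simp_all add: cl)
  qed
qed

theorem theorem7: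
  fixes m :: int
  shows "\<not> order_preserving 3
           (artin_gen 3 1 \<otimes>\<^bsub>braid_group 3\<^esub> (artin_gen 3 2 [^]\<^bsub>braid_group 3\<^esub> (2 * m + 1)))"
proof
  note One_nat_def [simp del]
  let ?\<beta> = "artin_gen 3 1 \<otimes>\<^bsub>braid_group 3\<^esub> (artin_gen 3 2 [^]\<^bsub>braid_group 3\<^esub> (2 * m + 1))"
  assume "order_preserving 3 ?\<beta>"
  then obtain P where P: "positive_cone (FG 3) P" and \<beta>P: "braid_action 3 ?\<beta> ` P = P"
    by (auto simp: order_preserving_def)
  define F where "F = FG 3"
  interpret F: group F unfolding F_def by (rule group_free_group)
  interpret A: group "AutoGroup F" by (rule F.AutoGroup)
  have "group_hom (braid_group 3) (AutoGroup F) (braid_action 3)"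
    unfolding group_hom_def group_hom_axioms_def F_def
    using group_braid_group A.is_group[unfolded F_def] braid_action_hom by blast
  then interpret act: group_hom "braid_group 3" "AutoGroup F" "braid_action 3" .
  define \<sigma> where "\<sigma> = artin_aut 3 1"
  define \<tau> where "\<tau> = artin_aut 3 2"
  define \<rho> where "\<rho> = \<tau> \<otimes>\<^bsub>AutoGroup F\<^esub> \<tau>"
  define \<beta> where "\<beta> = braid_action 3 ?\<beta>"
  define a b c where "a = gen (1::nat)" and "b = gen (2::nat)" and "c = gen (3::nat)"
  have carr [simp]: "a \<in> carrier F" "b \<in> carrier F" "c \<in> carrier F"
    by (simp_all add: a_def b_def c_def F_def)
  have \<sigma> [simp]: "\<sigma> \<in> carrier (AutoGroup F)" and \<tau> [simp]: "\<tau> \<in> carrier (AutoGroup F)"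
    by (simp_all add: \<sigma>_def \<tau>_def F_def artin_aut_auto)
  have \<rho> [simp]: "\<rho> \<in> carrier (AutoGroup F)" by (simp add: \<rho>_def)
  have braids: "artin_gen 3 1 \<in> carrier (braid_group 3)" "artin_gen 3 2 \<in> carrier (braid_group 3)"
    by (simp_all add: artin_gen_in_braid_group)
  \<comment> \<open>The exponent is split as \<open>1 + 2 * m\<close>, so that
    \<open>\<rho> = \<tau>\<tau>\<close> to the power \<open>m\<close> acts first, then
    \<open>\<tau>\<close>, then \<open>\<sigma>\<close>.\<close>
  have \<beta>: "\<beta> = \<sigma> \<otimes>\<^bsub>AutoGroup F\<^esub> (\<tau> \<otimes>\<^bsub>AutoGroup F\<^esub> \<rho> [^]\<^bsub>AutoGroup F\<^esub> m)"
  proof -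
    have "\<beta> = \<sigma> \<otimes>\<^bsub>AutoGroup F\<^esub> (\<tau> [^]\<^bsub>AutoGroup F\<^esub> (2 * m + 1))"
      by (simp add: \<beta>_def braids act.hom_int_pow braid_action_artin_gen \<sigma>_def \<tau>_def)
    also have "\<tau> [^]\<^bsub>AutoGroup F\<^esub> (2 * m + 1) = \<tau> \<otimes>\<^bsub>AutoGroup F\<^esub> \<tau> [^]\<^bsub>AutoGroup F\<^esub> (2 * m)"
      using A.int_pow_mult[of \<tau> 1 "2 * m"] by (simp add: add.commute)
    also have "\<tau> [^]\<^bsub>AutoGroup F\<^esub> (2 * m) = \<rho> [^]\<^bsub>AutoGroup F\<^esub> m"
      using A.int_pow_pow[of \<tau> 2 m] A.int_pow_mult[of \<tau> 1 1] by (simp add: \<rho>_def)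
    finally show ?thesis .
  qed
  then have \<beta>_aut: "\<beta> \<in> carrier (AutoGroup F)" by simp
  have \<beta>_app: "\<beta> x = \<sigma> (\<tau> ((\<rho> [^]\<^bsub>AutoGroup F\<^esub> m) x))" if "x \<in> carrier F" for x
  proof -
    have "(\<rho> [^]\<^bsub>AutoGroup F\<^esub> m) x \<in> carrier F"
      using F.AutoGroup_hom[of "\<rho> [^]\<^bsub>AutoGroup F\<^esub> m"] that by (simp add: group_hom.hom_closed)
    then show ?thesis using that by (simp add: \<beta> AutoGroup_mult)
  qed
  interpret \<sigma>: group_hom F F \<sigma> by (rule F.AutoGroup_hom) simp
  interpret \<tau>: group_hom F F \<tau> by (rule F.AutoGroup_hom) simp
  interpret \<beta>: group_hom F F \<beta> by (rule F.AutoGroup_hom[OF \<beta>_aut])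
  have \<sigma>_gen: "\<sigma> a = b" "\<sigma> b = inv\<^bsub>F\<^esub> b \<otimes>\<^bsub>F\<^esub> a \<otimes>\<^bsub>F\<^esub> b" "\<sigma> c = c"
    using artin_aut_gen[of 1 3] by (simp_all add: \<sigma>_def a_def b_def c_def F_def artin_fun_def)
  have \<tau>_gen: "\<tau> a = a" "\<tau> b = c" "\<tau> c = inv\<^bsub>F\<^esub> c \<otimes>\<^bsub>F\<^esub> b \<otimes>\<^bsub>F\<^esub> c"
    using artin_aut_gen[of 2 3] by (simp_all add: \<tau>_def a_def b_def c_def F_def artin_fun_def)
  define q where "q = b \<otimes>\<^bsub>F\<^esub> c"
  define d where "d = inv\<^bsub>F\<^esub> b \<otimes>\<^bsub>F\<^esub> a \<otimes>\<^bsub>F\<^esub> b \<otimes>\<^bsub>F\<^esub> c"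
  have [simp]: "q \<in> carrier F" "d \<in> carrier F" by (simp_all add: q_def d_def)
  have \<tau>q: "\<tau> q = q" and \<sigma>q: "\<sigma> q = d"
    by (simp_all add: q_def d_def \<tau>_gen \<sigma>_gen F.m_assoc F.mult_inv_cancel)
  \<comment> \<open>With \<open>q = b c\<close>, the conjugate of \<open>b\<close> by
    \<open>c\<close> is also its conjugate by \<open>q\<close>; a second application of
    \<open>\<tau>\<close> takes \<open>c\<close> to its conjugate by \<open>q\<close>.\<close>
  have \<rho>_gen: "\<rho> a = a" "\<rho> b = inv\<^bsub>F\<^esub> q \<otimes>\<^bsub>F\<^esub> b \<otimes>\<^bsub>F\<^esub> q" "\<rho> c = inv\<^bsub>F\<^esub> q \<otimes>\<^bsub>F\<^esub> c \<otimes>\<^bsub>F\<^esub> q" "\<rho> q = q"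
    by (simp_all add: \<rho>_def AutoGroup_mult \<tau>q)
       (simp_all add: q_def \<tau>_gen F.m_assoc F.mult_inv_cancel F.inv_mult_group)
  \<comment> \<open>The fixed generator \<open>a\<close> is treated as conjugated by the unit
    element.\<close>
  have \<rho>_pow: "(\<rho> [^]\<^bsub>AutoGroup F\<^esub> m) a = a"
    "(\<rho> [^]\<^bsub>AutoGroup F\<^esub> m) b = inv\<^bsub>F\<^esub> (q [^]\<^bsub>F\<^esub> m) \<otimes>\<^bsub>F\<^esub> b \<otimes>\<^bsub>F\<^esub> q [^]\<^bsub>F\<^esub> m"
    "(\<rho> [^]\<^bsub>AutoGroup F\<^esub> m) c = inv\<^bsub>F\<^esub> (q [^]\<^bsub>F\<^esub> m) \<otimes>\<^bsub>F\<^esub> c \<otimes>\<^bsub>F\<^esub> q [^]\<^bsub>F\<^esub> m"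
    using F.AutoGroup_int_pow_conj[of \<rho> "\<one>\<^bsub>F\<^esub>" a m] F.AutoGroup_int_pow_conj[of \<rho> q _ m]
      group_hom.hom_one[OF F.AutoGroup_hom[of \<rho>]]
    by (simp_all add: \<rho>_gen)
  \<comment> \<open>\<open>\<tau>\<close> fixes \<open>q\<close> and \<open>\<sigma>\<close> sends
    it to \<open>d\<close>, so conjugators \<open>q [^] m\<close> become
    \<open>d [^] m\<close>.\<close>
  have \<beta>_gen: "\<beta> a = b" "\<beta> b = inv\<^bsub>F\<^esub> (d [^]\<^bsub>F\<^esub> m) \<otimes>\<^bsub>F\<^esub> c \<otimes>\<^bsub>F\<^esub> d [^]\<^bsub>F\<^esub> m"
    "\<beta> c = inv\<^bsub>F\<^esub> (d [^]\<^bsub>F\<^esub> m)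
        \<otimes>\<^bsub>F\<^esub> (inv\<^bsub>F\<^esub> c \<otimes>\<^bsub>F\<^esub> (inv\<^bsub>F\<^esub> b \<otimes>\<^bsub>F\<^esub> a \<otimes>\<^bsub>F\<^esub> b) \<otimes>\<^bsub>F\<^esub> c) \<otimes>\<^bsub>F\<^esub> d [^]\<^bsub>F\<^esub> m"
    by (simp_all add: \<beta>_app \<rho>_pow \<tau>_gen \<sigma>_gen \<tau>.hom_int_pow \<sigma>.hom_int_pow \<tau>q \<sigma>q)
  define less where "less = (\<lambda>x y. inv\<^bsub>F\<^esub> x \<otimes>\<^bsub>F\<^esub> y \<in> P)"
  interpret ord: bi_ordered_group F less
    unfolding less_def using P by (intro F.bi_ordered_group_positive_cone) (simp add: F_def)
  interpret rev_ord: bi_ordered_group F "\<lambda>x y. less y x" by (rule ord.dual)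
  have mono: "less (\<beta> x) (\<beta> y)" if "x \<in> carrier F" "y \<in> carrier F" "less x y" for x y
  proof -
    have "\<beta> (inv\<^bsub>F\<^esub> x \<otimes>\<^bsub>F\<^esub> y) \<in> P" using \<beta>P that by (auto simp: less_def \<beta>_def)
    then show ?thesis using that by (simp add: less_def)
  qed
  have "\<not> less a b"
    by (rule ord.no_order_preserving_map[OF \<beta>.homh mono _ _ _ d_def \<beta>_gen]) auto
  moreover have "\<not> less b a"
    by (rule rev_ord.no_order_preserving_map[OF \<beta>.homh mono _ _ _ d_def \<beta>_gen]) auto
  moreover have "a \<noteq> b" by (simp add: a_def b_def gen_def)
  ultimately show False using ord.total[of a b] by simp
qed

end
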